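(* There exists a universal constant $c>0$ such that for every integer $n\geq 1$ there is a graph $G'$ on $n$ vertices of maximum degree at most three such that $$\hat r(G')\geq c\,n\,\exp\big(c\sqrt{\log n}\big),$$ where $\hat r(G')$ denotes the size-Ramsey number of $G'$.
   Context: The size-Ramsey number $\hat r(G')$ of a graph $G'$ is the smallest integer $m$ such that there exists a graph $G$ with $m$ edges with the property that every $2$-coloring of the edges of $G$ contains a monochromatic copy of $G'$ (that is, a subgraph of $G$ isomorphic to $G'$, all of whose edges have the same color).
   Formalization: The formal theorem is stated for every integer n ≥ 2 instead of n ≥ 1, since for n = 1 the only graph has no edges and size-Ramsey number 0, which is below the claimed bound c > 0. *)

theory Defs
  imports Complex_Main "HOL-Library.Ramsey"
begin

text \<open>A graph is a pair of a vertex set and an edge set; edges are 2-element sets of vertices.\<close>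

type_synonym 'a graph = "'a set \<times> 'a set set"

abbreviation verts :: "'a graph \<Rightarrow> 'a set" where "verts \<equiv> fst"
abbreviation edges :: "'a graph \<Rightarrow> 'a set set" where "edges \<equiv> snd"

definition fin_simple_graph :: "'a graph \<Rightarrow> bool" where
  "fin_simple_graph G \<longleftrightarrow> finite (verts G) \<and> edges G \<subseteq> [verts G]\<^bsup>2\<^esup>"

definition degree :: "'a graph \<Rightarrow> 'a \<Rightarrow> nat" where
  "degree G v = card {e \<in> edges G. v \<in> e}"

text \<open>Meaningful only for graphs with a nonempty finite vertex set.\<close>

definition max_degree :: "'a graph \<Rightarrow> nat" where
  "max_degree G = Max (degree G ` verts G)"

text \<open>Not necessarily induced.\<close>

definition subgraph :: "'a graph \<Rightarrow> 'a graph \<Rightarrow> bool" where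
  "subgraph H G \<longleftrightarrow> fin_simple_graph H \<and> verts H \<subseteq> verts G \<and> edges H \<subseteq> edges G"

definition graph_iso :: "'a graph \<Rightarrow> 'b graph \<Rightarrow> bool" where
  "graph_iso G H \<longleftrightarrow> (\<exists>f. bij_betw f (verts G) (verts H) \<and>
     (\<forall>u\<in>verts G. \<forall>v\<in>verts G. {u, v} \<in> edges G \<longleftrightarrow> {f u, f v} \<in> edges H))"

text \<open>A 2-coloring is a map to \<^typ>\<open>bool\<close>; its values off the edge set of the host are irrelevant.\<close>

definition mono_copy :: "('a set \<Rightarrow> bool) \<Rightarrow> 'a graph \<Rightarrow> 'b graph \<Rightarrow> bool" where
  "mono_copy col G G' \<longleftrightarrow>
     (\<exists>H. subgraph H G \<and> graph_iso H G' \<and> (\<forall>e\<in>edges H. \<forall>e'\<in>edges H. col e = col e'))"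

definition ramsey_host :: "'a graph \<Rightarrow> 'b graph \<Rightarrow> bool" where
  "ramsey_host G G' \<longleftrightarrow> fin_simple_graph G \<and> (\<forall>col. mono_copy col G G')"

text \<open>Every finite graph is isomorphic to one on natural numbers, so hosts are taken there. By
  \<open>ramsey_host_exists\<close> below, some \<open>m\<close> qualifies, so \<open>LEAST\<close> is a genuine minimum.\<close>

definition size_ramsey :: "'b graph \<Rightarrow> nat" where
  "size_ramsey G' = (LEAST m. \<exists>G :: nat graph. ramsey_host G G' \<and> card (edges G) = m)"

lemma mono_copy_of_clique:
  fixes G :: "'a graph" and G' :: "'b graph"
  assumes "fin_simple_graph G'" and "R \<subseteq> verts G" and "finite R" and "card R = card (verts G')"
    and "[R]\<^bsup>2\<^esup> \<subseteq> edges G" and mono: "\<And>e. e \<in> [R]\<^bsup>2\<^esup> \<Longrightarrow> col e = b"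
  shows "mono_copy col G G'"
proof -
  have E': "edges G' \<subseteq> [verts G']\<^bsup>2\<^esup>" and "finite (verts G')"
    using assms(1) by (auto simp: fin_simple_graph_def)
  then obtain f where f: "bij_betw f R (verts G')"
    using finite_same_card_bij[OF \<open>finite R\<close>] assms(4) by blast
  define H where "H = (R, {e \<in> [R]\<^bsup>2\<^esup>. f ` e \<in> edges G'})"
  have "subgraph H G"
    using assms by (auto simp: subgraph_def fin_simple_graph_def H_def)
  moreover have "{u, v} \<in> edges H \<longleftrightarrow> {f u, f v} \<in> edges G'" if "u \<in> R" "v \<in> R" for u v
  proof
    assume *: "{f u, f v} \<in> edges G'"
    then have "card {f u, f v} = 2"
      using E' by (auto simp: nsets_def)
    then have "u \<noteq> v" by auto
    then have "{u, v} \<in> [R]\<^bsup>2\<^esup>"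
      using that by (simp add: nsets_def)
    with * show "{u, v} \<in> edges H" by (simp add: H_def)
  qed (simp add: H_def)
  then have "graph_iso H G'"
    using f unfolding graph_iso_def H_def by auto
  moreover have "\<forall>e\<in>edges H. \<forall>e'\<in>edges H. col e = col e'"
    using mono by (simp add: H_def)
  ultimately show ?thesis
    unfolding mono_copy_def by blast
qed

lemma ramsey_host_exists:
  assumes "fin_simple_graph G'"
  shows "\<exists>G :: nat graph. ramsey_host G G'"
proof -
  let ?k = "card (verts G')"
  obtain r where r: "\<And>(V :: nat set) E. \<lbrakk>finite V; card V \<ge> r\<rbrakk> \<Longrightarrow>
      \<exists>R\<subseteq>V. card R = ?k \<and> clique R E \<or> card R = ?k \<and> indep R E"
    using ramsey2[of ?k ?k] by metis
  let ?V = "{..<r}"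
  let ?G = "(?V, [?V]\<^bsup>2\<^esup>)"
  have "mono_copy col ?G G'" for col
  proof -
    obtain R where R: "R \<subseteq> ?V" "card R = ?k" "clique R {e. col e} \<or> indep R {e. col e}"
      using r[of ?V "{e. col e}"] by auto
    have "col e = clique R {e. col e}" if "e \<in> [R]\<^bsup>2\<^esup>" for e
      using that R(3) by (fastforce simp: clique_def indep_def nsets_def card_2_iff)
    with R(1,2) show ?thesis
      by (intro mono_copy_of_clique[OF assms, of R])
         (auto intro: finite_subset dest: nsets_mono[of R ?V 2])
  qed
  then show ?thesis
    unfolding ramsey_host_def by (intro exI[of _ ?G]) (auto simp: fin_simple_graph_def)
qed

text \<open>The one-vertex graph has size-Ramsey number 0, so no positive lower bound holds for it.\<close>

lemma size_ramsey_one_vertex: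
  assumes "fin_simple_graph G'" and "card (verts G') = 1"
  shows "size_ramsey G' = 0"
proof -
  let ?G = "({0}, {}) :: nat graph"
  have "[{0 :: nat}]\<^bsup>2\<^esup> = {}"
    by (auto simp: nsets_def card_2_iff)
  then have "ramsey_host ?G G'"
    unfolding ramsey_host_def
    by (auto simp: fin_simple_graph_def assms intro!: mono_copy_of_clique[OF assms(1), of "{0}"])
  then have "\<exists>G :: nat graph. ramsey_host G G' \<and> card (edges G) = 0"
    by (intro exI[of _ ?G]) simp
  then show ?thesis
    unfolding size_ramsey_def by (simp add: Least_eq_0)
qed

end

theory Submission
  imports Defs "HOL-Combinatorics.Permutations" "HOL-Library.FuncSet"
begin

text \<open>
  The graph \<open>G'\<close> is a disjoint union of \<open>s\<close> small graphs of maximum degree three.  Each of them is a complete binary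
  tree with \<open>2 * h\<close> leaves, \<open>h = 2 ^ l\<close>, together with a perfect matching between the left and the
  right half of the leaves, given by a permutation \<open>\<pi>\<close> of \<open>{..<h}\<close>.  The \<open>s\<close> permutations
  are chosen at random.  Two features of these graphs matter: there are \<open>h!\<close> types, which beats
  every \<open>D ^ (6 * h)\<close> for \<open>D\<close> a small power of \<open>h\<close>; and yet the radius is only logarithmic in \<open>h\<close>, so that
  a ball in a graph of maximum degree \<open>D\<close> which could contain a copy has only about
  \<open>D ^ (l + 2)\<close> vertices.

  Fix a root \<open>v\<close> in a graph of maximum degree \<open>D\<close>.  An embedding of a matched tree that sends its
  root to \<open>v\<close> is described by the neighbour chosen at each step, at most \<open>D ^ (6 * h)\<close> possibilities
  (\<open>embedding_imp_decodable\<close>, \<open>card_decodable_le\<close>).  The only other information needed to recover \<open>\<pi>\<close>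
  is which pairs of walks from \<open>v\<close> end in the same vertex, and there are at most
  \<open>2 ^ D ^ (2 * l + 3)\<close> such coincidence relations.  So a union bound over coincidence
  relations, rather than over whole host graphs, gives a choice of
  types for which every root in every graph of maximum degree \<open>D\<close> sees at most
  \<open>q = D ^ (2 * l + 3) + 1\<close> of the \<open>s\<close> types (\<open>exists_rarely_decodable_family\<close>).

  Now let \<open>G\<close> have fewer than \<open>n * D / 48\<close> edges.  Few vertices have degree above \<open>D\<close>; call their set \<open>L\<close>.
  Away from \<open>L\<close> the average type occurs at few roots because \<open>q\<close> is small compared with \<open>s\<close>, so some type \<open>a\<close>
  has a small set \<open>R\<close> of roots (\<open>few_roots\<close>).  Give one colour to the edges that avoid \<open>L \<union> R\<close> and the
  other colour to the rest.  The first colour contains no copy of the component of type \<open>a\<close>, hence no copy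
  of \<open>G'\<close>.  In the second colour \<open>L \<union> R\<close> would be a vertex cover of a copy of \<open>G'\<close>, but a graph of
  maximum degree three with \<open>n / 4\<close> edges has no vertex cover with fewer than \<open>n / 12\<close> vertices
  (\<open>ramsey_host_edges_ge\<close>).

  Hence the size-Ramsey number is at least \<open>n * D / 48\<close> as soon as the ball size, a power
  \<open>D ^ O(log h)\<close>, stays below \<open>n\<close>.  With \<open>D = 2 ^ j\<close> and \<open>h = 2 ^ (10 * j)\<close> this means that
  \<open>j\<^sup>2\<close> is of order \<open>ln n\<close>, which is where \<open>exp (c * sqrt (ln n))\<close> comes from.
\<close>

section \<open>Matched trees and walks in a host of bounded degree\<close>

text \<open>
  The tree has the heap numbering: the root is \<open>1\<close>, the parent of \<open>i\<close> is \<open>i div 2\<close>, and the leaves are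
  \<open>2 * h, ..., 4 * h - 1\<close>.  The number \<open>0\<close> is unused, so that a component fits in a block of
  \<open>4 * h\<close> numbers.
\<close>

definition rooted_embedding :: "nat \<Rightarrow> (nat \<Rightarrow> nat) \<Rightarrow> ('v \<Rightarrow> 'v \<Rightarrow> bool) \<Rightarrow> (nat \<Rightarrow> 'v) \<Rightarrow> bool" where
  "rooted_embedding h \<pi> adj \<phi> \<longleftrightarrow> inj_on \<phi> {1..<4*h} \<and>
     (\<forall>i\<in>{2..<4*h}. adj (\<phi> (i div 2)) (\<phi> i)) \<and>
     (\<forall>i<h. adj (\<phi> (2*h + i)) (\<phi> (3*h + \<pi> i)))"

text \<open>
  If \<open>c i\<close> says which neighbour of the parent is used for node \<open>i\<close>, then \<open>addr c j\<close> is the route from the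
  root to node \<open>j\<close>, last step first.
\<close>
fun addr :: "(nat \<Rightarrow> nat) \<Rightarrow> nat \<Rightarrow> nat list" where
  "addr c j = (if j \<le> 1 then [] else c j # addr c (j div 2))"

declare addr.simps [simp del]

definition words :: "nat \<Rightarrow> nat \<Rightarrow> nat list set" where
  "words D d = {w. set w \<subseteq> {..<D} \<and> length w = d}"

primrec walk :: "('v \<Rightarrow> nat \<Rightarrow> 'v) \<Rightarrow> 'v \<Rightarrow> nat list \<Rightarrow> 'v" where
  "walk nb v [] = v"
| "walk nb v (a # w) = nb (walk nb v w) a"

definition codes :: "nat \<Rightarrow> nat \<Rightarrow> (nat \<Rightarrow> nat) set" where
  "codes D h = {..<6*h} \<rightarrow>\<^sub>E {..<D}"

text \<open>
  The partner of leaf \<open>2 * h + i\<close> is reached by one more step from that leaf.  This step is recorded as if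
  it led to the left heap child \<open>2 * (2 * h + i) = 4 * h + 2 * i\<close> of the leaf, so that one function \<open>c\<close>
  encodes both the tree and the matching, with indices below \<open>6 * h\<close>.  The relation \<open>E\<close> stands for the pairs of routes with the
  same end point: with it, \<open>c\<close> determines the partner, and so \<open>\<pi>\<close>, without any reference to a host.
\<close>
definition decodable :: "nat \<Rightarrow> nat \<Rightarrow> (nat list \<times> nat list) set \<Rightarrow> (nat \<Rightarrow> nat) set" where
  "decodable D h E = {\<pi>. \<pi> permutes {..<h} \<and> (\<exists>c\<in>codes D h.
     \<forall>i<h. \<forall>l<h. (addr c (4*h + 2*i), addr c (3*h + l)) \<in> E \<longleftrightarrow> l = \<pi> i)}"

lemma finite_words [simp]: "finite (words D d)"
  unfolding words_def by (rule finite_lists_length_eq) simp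

lemma card_words: "card (words D d) = D ^ d"
  unfolding words_def by (subst card_lists_length_eq) simp_all

lemma addr_in_words:
  assumes "\<And>i. i < 6*h \<Longrightarrow> c i < D" and "j < 6*h" and "2^d \<le> j" and "j < 2^(d+1)"
  shows "addr c j \<in> words D d"
  using assms(2-)
proof (induction d arbitrary: j)
  case 0
  then show ?case by (simp add: addr.simps words_def)
next
  case (Suc d)
  then have "addr c (j div 2) \<in> words D d"
    by (intro Suc.IH) auto
  moreover have "2 \<le> j"
    using Suc.prems(2) by (metis le_trans one_le_power one_le_numeral power_Suc mult_le_mono2 mult_1_right)
  ultimately show ?case
    using assms(1)[OF Suc.prems(1)] by (simp add: addr.simps[of c j] words_def)
qed

text \<open>
  A permutation is determined by any of its codes: \<open>\<pi> i\<close> is the unique \<open>l < h\<close> whose leaf is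
  \<open>E\<close>-related to the extra step from leaf \<open>2 * h + i\<close>.
\<close>
lemma card_decodable_le: "card (decodable D h E) \<le> D ^ (6*h)"
proof -
  define good where "good \<pi> c \<longleftrightarrow> c \<in> codes D h \<and>
    (\<forall>i<h. \<forall>l<h. (addr c (4*h + 2*i), addr c (3*h + l)) \<in> E \<longleftrightarrow> l = \<pi> i)" for \<pi> c
  define code where "code \<pi> = (SOME c. good \<pi> c)" for \<pi>
  have code: "good \<pi> (code \<pi>)" if "\<pi> \<in> decodable D h E" for \<pi>
  proof -
    have "\<exists>c. good \<pi> c" using that by (auto simp: decodable_def good_def)
    then show ?thesis unfolding code_def by (rule someI_ex)
  qed
  have "inj_on code (decodable D h E)"
  proof (rule inj_onI)
    fix \<pi> \<rho>
    assume \<pi>: "\<pi> \<in> decodable D h E" and \<rho>: "\<rho> \<in> decodable D h E" and eq: "code \<pi> = code \<rho>"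
    have perm: "\<pi> permutes {..<h}" "\<rho> permutes {..<h}"
      using \<pi> \<rho> by (auto simp: decodable_def)
    show "\<pi> = \<rho>"
    proof
      fix i
      show "\<pi> i = \<rho> i"
      proof (cases "i < h")
        case True
        then have "\<pi> i < h"
          using permutes_in_image[OF perm(1), of i] by simp
        then show ?thesis
          using code[OF \<pi>] code[OF \<rho>] True eq by (auto simp: good_def)
      next
        case False
        then show ?thesis
          using perm by (simp add: permutes_def)
      qed
    qed
  qed
  moreover have "code ` decodable D h E \<subseteq> codes D h"
    using code by (auto simp: good_def)
  moreover have "finite (codes D h)"
    unfolding codes_def by (intro finite_PiE) auto
  ultimately have "card (decodable D h E) \<le> card (codes D h)"
    by (rule card_inj_on_le)
  then show ?thesis
    by (simp add: codes_def card_PiE)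
qed

text \<open>
  The coincidence relation of the walks from the root decodes \<open>\<pi>\<close> because the embedding is injective on
  the leaves: the walk that continues through the matching edge at leaf \<open>2 * h + i\<close> ends at the image of
  leaf \<open>3 * h + \<pi> i\<close> and at that of no other leaf.
\<close>
lemma embedding_imp_decodable:
  assumes emb: "rooted_embedding h \<pi> adj \<phi>" and perm: "\<pi> permutes {..<h}" and h: "h = 2^l"
    and nb: "\<And>u v. adj u v \<Longrightarrow> \<exists>a<D. nb u a = v" and "D > 0"
  shows "\<pi> \<in> decodable D h {(u, w) \<in> words D (l+2) \<times> words D (l+1).
           walk nb (\<phi> 1) u = walk nb (\<phi> 1) w}"
    (is "_ \<in> decodable D h ?E")
proof -
  have "h > 0" using h by simp
  \<comment> \<open>The embedding, extended to the fictitious children \<open>4 * h + 2 * i\<close>, which sit at the matching partners.\<close>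
  define \<psi> where "\<psi> j = (if j < 4*h then \<phi> j else \<phi> (3*h + \<pi> ((j - 4*h) div 2)))" for j
  define J where "J = {2..<4*h} \<union> (\<lambda>i. 4*h + 2*i) ` {..<h}"
  have adj: "adj (\<psi> (j div 2)) (\<psi> j)" if "j \<in> J" for j
    using that emb by (fastforce simp: J_def \<psi>_def rooted_embedding_def)
  define c where "c = (\<lambda>j\<in>{..<6*h}. if j \<in> J then SOME a. a < D \<and> nb (\<psi> (j div 2)) a = \<psi> j else 0)"
  have J6: "j < 6*h" if "j \<in> J" for j
    using that by (auto simp: J_def)
  have some: "(SOME a. a < D \<and> nb (\<psi> (j div 2)) a = \<psi> j) < D \<and>
      nb (\<psi> (j div 2)) (SOME a. a < D \<and> nb (\<psi> (j div 2)) a = \<psi> j) = \<psi> j" if "j \<in> J" for j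
    using nb[OF adj[OF that]] by (rule someI_ex)
  have c_step: "nb (\<psi> (j div 2)) (c j) = \<psi> j" if "j \<in> J" for j
    using some[OF that] J6[OF that] that by (simp add: c_def)
  have c_less: "c j < D" if "j < 6*h" for j
    using some[of j] that \<open>D > 0\<close> by (simp add: c_def)
  have c_code: "c \<in> codes D h"
    using c_less by (auto simp: codes_def c_def)
  have walk: "walk nb (\<phi> 1) (addr c j) = \<psi> j" if "j = 1 \<or> j \<in> J" for j
    using that
  proof (induction j rule: less_induct)
    case (less j)
    show ?case
    proof (cases "j = 1")
      case True
      then show ?thesis
        using \<open>h > 0\<close> by (simp add: addr.simps \<psi>_def)
    next
      case False
      then have j: "j \<in> J" using less.prems by simp
      then have j2: "2 \<le> j"
        using \<open>h > 0\<close> by (auto simp: J_def)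
      have "j div 2 = 1 \<or> j div 2 \<in> J"
        using j by (auto simp: J_def)
      then have "walk nb (\<phi> 1) (addr c (j div 2)) = \<psi> (j div 2)"
        using j2 by (intro less.IH) auto
      then show ?thesis
        using c_step[OF j] j2 by (simp add: addr.simps[of c j])
    qed
  qed
  have "(addr c (4*h + 2*i), addr c (3*h + m)) \<in> ?E \<longleftrightarrow> m = \<pi> i" if "i < h" "m < h" for i m
  proof -
    have "addr c (4*h + 2*i) \<in> words D (l+2)"
      by (rule addr_in_words[OF c_less]) (use that h in auto)
    moreover have "addr c (3*h + m) \<in> words D (l+1)"
      by (rule addr_in_words[OF c_less]) (use that h in auto)
    moreover have "walk nb (\<phi> 1) (addr c (4*h + 2*i)) = \<phi> (3*h + \<pi> i)"
      using that by (subst walk) (auto simp: J_def \<psi>_def)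
    moreover have "walk nb (\<phi> 1) (addr c (3*h + m)) = \<phi> (3*h + m)"
      using that by (subst walk) (auto simp: J_def \<psi>_def)
    moreover have "\<phi> (3*h + \<pi> i) = \<phi> (3*h + m) \<longleftrightarrow> 3*h + \<pi> i = 3*h + m"
    proof (rule inj_on_eq_iff)
      show "inj_on \<phi> {1..<4*h}" using emb by (simp add: rooted_embedding_def)
      show "3*h + \<pi> i \<in> {1..<4*h}" "3*h + m \<in> {1..<4*h}"
        using that permutes_in_image[OF perm, of i] by auto
    qed
    ultimately show ?thesis by auto
  qed
  then show ?thesis
    using perm c_code unfolding decodable_def by blast
qed

section \<open>Choosing the types at random\<close>

text \<open>
  An exponential moment bound.  For a uniformly random \<open>f\<close> and a fixed \<open>E\<close>, the values \<open>f a\<close> are independent and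
  lie in \<open>P E\<close> with probability at most \<open>1 / s\<close>, so the expectation of \<open>2 ^ card {a. f a \<in> P E}\<close>
  is at most \<open>(1 + 1 / s) ^ s \<le> exp 1 \<le> 3\<close>.  Summing over \<open>E\<close>, some \<open>f\<close> keeps the
  sum of these powers within its expectation, at most \<open>3 * card I\<close>, and then every single term obeys that bound.
\<close>
lemma choice_avoiding_small_sets:
  fixes P :: "'e \<Rightarrow> 'a set"
  assumes fin: "finite \<Omega>" "finite I" and ne: "\<Omega> \<noteq> {}" and "s > 0"
    and small: "\<And>E. E \<in> I \<Longrightarrow> P E \<subseteq> \<Omega> \<and> s * card (P E) \<le> card \<Omega>"
  shows "\<exists>f \<in> {..<s} \<rightarrow> \<Omega>. \<forall>E\<in>I. 2 ^ card {a\<in>{..<s}. f a \<in> P E} \<le> 3 * card I"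
proof -
  let ?F = "{..<s} \<rightarrow>\<^sub>E \<Omega>"
  let ?w = "\<lambda>f E. (2::real) ^ card {a\<in>{..<s}. f a \<in> P E}"
  have finF: "finite ?F" using fin by (intro finite_PiE) auto
  have one: "(\<Sum>f\<in>?F. ?w f E) \<le> 3 * real (card \<Omega>) ^ s" if E: "E \<in> I" for E
  proof -
    have "?w f E = (\<Prod>a<s. if f a \<in> P E then 2 else 1)" for f
      by (simp add: prod.If_cases Int_def)
    then have "(\<Sum>f\<in>?F. ?w f E) = (\<Sum>f\<in>?F. \<Prod>a<s. if f a \<in> P E then 2 else 1)"
      by simp
    also have "\<dots> = (\<Prod>a<s. \<Sum>x\<in>\<Omega>. if x \<in> P E then 2 else 1)"
      using fin by (subst prod_sum_PiE) auto
    also have "(\<Sum>x\<in>\<Omega>. if x \<in> P E then 2 else 1 :: real) = (\<Sum>x\<in>\<Omega>. 1 + (if x \<in> P E then 1 else 0))"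
      by (rule sum.cong) auto
    also have "\<dots> = real (card \<Omega>) + real (card (P E))"
      using fin small[OF E] by (simp add: sum.distrib sum.If_cases Int_absorb1)
    also have "(\<Prod>a<s. real (card \<Omega>) + real (card (P E))) \<le> (real (card \<Omega>) * exp (1 / s)) ^ s"
    proof -
      have "real s * real (card (P E)) \<le> real (card \<Omega>)"
        using small[OF E] by (metis of_nat_le_iff of_nat_mult)
      then have "real (card \<Omega>) + real (card (P E)) \<le> real (card \<Omega>) * (1 + 1 / s)"
        using \<open>s > 0\<close> by (simp add: field_simps)
      also have "\<dots> \<le> real (card \<Omega>) * exp (1 / s)"
        by (intro mult_left_mono exp_ge_add_one_self) auto
      finally show ?thesis by (simp add: power_mono)
    qed
    also have "\<dots> = real (card \<Omega>) ^ s * exp 1"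
      using \<open>s > 0\<close> by (simp add: power_mult_distrib flip: exp_of_nat_mult)
    also have "\<dots> \<le> 3 * real (card \<Omega>) ^ s"
      using mult_left_mono[OF exp_le, of "real (card \<Omega>) ^ s"] by (simp add: mult.commute)
    finally show ?thesis .
  qed
  have "\<exists>f\<in>?F. (\<Sum>E\<in>I. ?w f E) \<le> 3 * real (card I)"
  proof (rule ccontr)
    assume "\<not> ?thesis"
    then have "(\<Sum>f\<in>?F. 3 * real (card I)) < (\<Sum>f\<in>?F. \<Sum>E\<in>I. ?w f E)"
      using ne finF by (intro sum_strict_mono) (auto simp: PiE_eq_empty_iff not_le)
    also have "\<dots> = (\<Sum>E\<in>I. \<Sum>f\<in>?F. ?w f E)"
      by (rule sum.swap)
    also have "\<dots> \<le> (\<Sum>E\<in>I. 3 * real (card \<Omega>) ^ s)"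
      by (intro sum_mono one)
    finally show False
      by (simp add: card_PiE mult.commute)
  qed
  then obtain f where f: "f \<in> ?F" and bound: "(\<Sum>E\<in>I. ?w f E) \<le> 3 * real (card I)" by blast
  have "2 ^ card {a\<in>{..<s}. f a \<in> P E} \<le> 3 * card I" if E: "E \<in> I" for E
  proof -
    have "?w f E \<le> (\<Sum>E\<in>I. ?w f E)"
      using fin E by (intro member_le_sum) auto
    with bound have "real (2 ^ card {a\<in>{..<s}. f a \<in> P E}) \<le> real (3 * card I)" by simp
    then show ?thesis by (simp only: of_nat_le_iff)
  qed
  then show ?thesis
    using f by (intro bexI[of _ f]) (auto simp: PiE_def)
qed

text \<open>
  There are \<open>2 ^ D ^ (2 * l + 3)\<close> relations \<open>E\<close> between words of lengths \<open>l + 2\<close> and \<open>l + 1\<close>, and the bound on the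
  number of indices is, up to rounding, the binary logarithm of three times this number.
\<close>
lemma exists_rarely_decodable_family:
  assumes "s > 0" and "D ^ (6*h) * s \<le> fact h"
  shows "\<exists>f. (\<forall>a<s. f a permutes {..<h}) \<and>
    (\<forall>E \<subseteq> words D (l+2) \<times> words D (l+1).
       card {a\<in>{..<s}. f a \<in> decodable D h E} \<le> D ^ (2*l+3) + 1)"
proof -
  let ?I = "Pow (words D (l+2) \<times> words D (l+1))"
  have card_I: "card ?I = 2 ^ D ^ (2*l+3)"
  proof -
    have "(l + 2) + (l + 1) = 2*l + 3" by simp
    then have "D ^ (l+2) * D ^ (l+1) = D ^ (2*l+3)" by (metis power_add)
    then show ?thesis by (simp add: card_Pow card_cartesian_product card_words)
  qed
  have "\<exists>f \<in> {..<s} \<rightarrow> {\<pi>. \<pi> permutes {..<h}}.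
      \<forall>E\<in>?I. 2 ^ card {a\<in>{..<s}. f a \<in> decodable D h E} \<le> 3 * card ?I"
  proof (rule choice_avoiding_small_sets)
    show "finite {\<pi>. \<pi> permutes {..<h}}" by (intro finite_permutations) simp
    show "{\<pi>. \<pi> permutes {..<h}} \<noteq> {}" using permutes_id by blast
    fix E
    have "s * card (decodable D h E) \<le> s * D ^ (6*h)"
      by (intro mult_left_mono card_decodable_le) simp
    also have "\<dots> \<le> card {\<pi>. \<pi> permutes {..<h}}"
      using assms(2) by (subst card_permutations[OF refl]) (simp_all add: mult.commute)
    finally show "decodable D h E \<subseteq> {\<pi>. \<pi> permutes {..<h}} \<and>
        s * card (decodable D h E) \<le> card {\<pi>. \<pi> permutes {..<h}}"
      by (auto simp: decodable_def)
  qed (use \<open>s > 0\<close> in auto)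
  then obtain f where f: "f \<in> {..<s} \<rightarrow> {\<pi>. \<pi> permutes {..<h}}"
    and bound: "\<And>E. E \<in> ?I \<Longrightarrow>
      2 ^ card {a\<in>{..<s}. f a \<in> decodable D h E} \<le> 3 * (2::nat) ^ D ^ (2*l+3)"
    unfolding card_I by blast
  have "card {a\<in>{..<s}. f a \<in> decodable D h E} \<le> D ^ (2*l+3) + 1" if "E \<in> ?I" for E
  proof -
    have "2 ^ card {a\<in>{..<s}. f a \<in> decodable D h E} \<le> 3 * (2::nat) ^ D ^ (2*l+3)"
      by (rule bound[OF that])
    also have "\<dots> < 2 ^ (D ^ (2*l+3) + 2)" by simp
    finally have "card {a\<in>{..<s}. f a \<in> decodable D h E} < D ^ (2*l+3) + 2"
      by (rule power_less_imp_less_exp[rotated]) simp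
    then show ?thesis by simp
  qed
  with f show ?thesis by (intro exI[of _ f]) auto
qed

section \<open>The disjoint union of matched trees\<close>
definition tree_edges :: "nat \<Rightarrow> nat \<Rightarrow> nat set set" where
  "tree_edges h s = (\<lambda>(a, i). {4*h*a + i div 2, 4*h*a + i}) ` ({..<s} \<times> {2..<4*h})"

definition matching_edges :: "nat \<Rightarrow> nat \<Rightarrow> (nat \<Rightarrow> nat \<Rightarrow> nat) \<Rightarrow> nat set set" where
  "matching_edges h s f = (\<lambda>(a, i). {4*h*a + (2*h + i), 4*h*a + (3*h + f a i)}) ` ({..<s} \<times> {..<h})"

text \<open>
  Component \<open>a\<close> lives on the block \<open>{4*h*a..<4*h*(a+1)}\<close>.  The numbers \<open>4*h*a\<close> and those beyond the last
  full block are isolated vertices, which bring the order to exactly \<open>n\<close>.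
\<close>
definition matched_forest :: "nat \<Rightarrow> nat \<Rightarrow> (nat \<Rightarrow> nat \<Rightarrow> nat) \<Rightarrow> nat graph" where
  "matched_forest n h f = ({..<n}, tree_edges h (n div (4*h)) \<union> matching_edges h (n div (4*h)) f)"

lemma block_less:
  fixes n m a r :: nat
  assumes "a < n div m" and "r < m"
  shows "m * a + r < n"
proof -
  have "m * a + r < m * Suc a" using assms(2) by simp
  also have "\<dots> \<le> m * (n div m)" using assms(1) by (intro mult_le_mono2) simp
  also have "\<dots> \<le> n" by simp
  finally show ?thesis .
qed

lemma matched_forest_simple:
  assumes perm: "\<And>a. a < n div (4*h) \<Longrightarrow> f a permutes {..<h}"
  shows "fin_simple_graph (matched_forest n h f)"
proof -
  have "tree_edges h (n div (4*h)) \<subseteq> [{..<n}]\<^bsup>2\<^esup>"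
  proof
    fix e assume "e \<in> tree_edges h (n div (4*h))"
    then obtain a i where ai: "a < n div (4*h)" "2 \<le> i" "i < 4*h"
      and e: "e = {4*h*a + i div 2, 4*h*a + i}"
      by (auto simp: tree_edges_def)
    have "4*h*a + i div 2 < n" "4*h*a + i < n"
      using ai by (auto intro!: block_less)
    moreover have "i div 2 \<noteq> i" using ai(2) by simp
    ultimately show "e \<in> [{..<n}]\<^bsup>2\<^esup>"
      by (simp add: e nsets_def)
  qed
  moreover have "matching_edges h (n div (4*h)) f \<subseteq> [{..<n}]\<^bsup>2\<^esup>"
  proof
    fix e assume "e \<in> matching_edges h (n div (4*h)) f"
    then obtain a i where ai: "a < n div (4*h)" "i < h"
      and e: "e = {4*h*a + (2*h + i), 4*h*a + (3*h + f a i)}"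
      by (auto simp: matching_edges_def)
    have "f a i < h"
      using permutes_in_image[OF perm[OF ai(1)], of i] ai(2) by simp
    then have "4*h*a + (2*h + i) < n" "4*h*a + (3*h + f a i) < n"
      using ai(2) by (simp_all add: block_less[OF ai(1)])
    then show "e \<in> [{..<n}]\<^bsup>2\<^esup>"
      using ai(2) by (simp add: e nsets_def)
  qed
  ultimately show ?thesis
    by (simp add: fin_simple_graph_def matched_forest_def)
qed

text \<open>
  An inner node has a parent and two children; a leaf has a parent and one partner.
\<close>
lemma matched_forest_degree_le:
  assumes perm: "\<And>a. a < n div (4*h) \<Longrightarrow> f a permutes {..<h}"
  shows "degree (matched_forest n h f) x \<le> 3"
proof -
  define a where "a = x div (4*h)"
  define r where "r = x mod (4*h)"
  let ?E = "edges (matched_forest n h f)"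
  let ?v = "\<lambda>i. 4*h*a + i"
  have x: "x = ?v r" by (simp add: a_def r_def)
  have coords: "a' = a \<and> i = r" if "x = 4*h*a' + i" "i < 4*h" for a' i
    using that by (simp add: a_def r_def)
  \<comment> \<open>All edges that can contain \<open>x\<close>.  Both possible partners of a leaf are listed, as only one applies, depending on its half.\<close>
  define T where "T = (if r < 2*h then {{?v (r div 2), x}, {x, ?v (2*r)}, {x, ?v (2*r+1)}}
    else {{?v (r div 2), x}, {x, ?v (3*h + f a (r - 2*h))}, {?v (2*h + inv (f a) (r - 3*h)), x}})"
  have "{e \<in> ?E. x \<in> e} \<subseteq> T"
  proof
    fix e assume "e \<in> {e \<in> ?E. x \<in> e}"
    then consider
      (tree) a' i where "a' < n div (4*h)" "2 \<le> i" "i < 4*h"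
        "e = {4*h*a' + i div 2, 4*h*a' + i}" "x \<in> e"
    | (matching) a' i where "a' < n div (4*h)" "i < h"
        "e = {4*h*a' + (2*h + i), 4*h*a' + (3*h + f a' i)}" "x \<in> e"
      by (auto simp: matched_forest_def tree_edges_def matching_edges_def)
    then show "e \<in> T"
    proof cases
      case tree
      then consider "x = 4*h*a' + i div 2" | "x = 4*h*a' + i" by auto
      then show ?thesis
      proof cases
        case 1
        then have a': "a' = a" and r: "r = i div 2"
          using coords[of a' "i div 2"] tree by auto
        have "r < 2*h" using r tree by simp
        moreover have "i = 2*r \<or> i = 2*r+1" using r by auto
        moreover have "e = {x, ?v i}" using tree(4) a' 1 by simp
        ultimately show ?thesis by (auto simp: T_def)
      next
        case 2
        then have "a' = a" "r = i" using coords[of a' i] tree by auto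
        then show ?thesis using tree(4) 2 by (auto simp: T_def)
      qed
    next
      case matching
      have perm': "f a' permutes {..<h}" by (rule perm[OF matching(1)])
      then have fi: "f a' i < h"
        using permutes_in_image[of "f a'" "{..<h}" i] matching(2) by simp
      consider "x = 4*h*a' + (2*h + i)" | "x = 4*h*a' + (3*h + f a' i)"
        using matching by auto
      then show ?thesis
      proof cases
        case 1
        then have "a' = a \<and> 2*h + i = r" using coords[of a' "2*h + i"] matching by simp
        then have "a' = a" "r = 2*h + i" by auto
        then show ?thesis using matching(3) 1 by (auto simp: T_def)
      next
        case 2
        moreover have "3*h + f a' i < 4*h" using fi by simp
        ultimately have "a' = a" "3*h + f a' i = r" using coords by blast+
        then have *: "a' = a" "r = 3*h + f a i" by simp_all
        then have "inv (f a) (r - 3*h) = i"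
          using permutes_inverses(2)[OF perm'] by simp
        then show ?thesis using matching(3) 2 * by (auto simp: T_def)
      qed
    qed
  qed
  moreover have "card {A, B, C} \<le> 3" for A B C :: "nat set"
    by (simp add: card_insert_if)
  then have "finite T" "card T \<le> 3"
    by (simp_all add: T_def)
  ultimately show ?thesis
    unfolding degree_def by (meson card_mono order_trans)
qed

lemma card_tree_edges: "card (tree_edges h s) = s * (4*h - 2)"
proof -
  have "inj_on (\<lambda>(a, i). {4*h*a + i div 2, 4*h*a + i}) ({..<s} \<times> {2..<4*h})"
  proof (rule inj_onI, clarsimp)
    fix a i b j
    assume less: "i < 4*h" "j < 4*h"
      and eq: "{4*h*a + i div 2, 4*h*a + i} = {4*h*b + j div 2, 4*h*b + j}"
    \<comment> \<open>The larger endpoint of a tree edge is the child, and a child has only one parent edge.\<close>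
    have "Max {4*h*a + i div 2, 4*h*a + i} = Max {4*h*b + j div 2, 4*h*b + j}"
      using eq by simp
    then have *: "4*h*a + i = 4*h*b + j"
      by (simp add: max_def split: if_splits)
    have "(4*h*a + i) div (4*h) = a" "(4*h*b + j) div (4*h) = b"
      using less by auto
    with * show "a = b \<and> i = j" by auto
  qed
  then show ?thesis
    unfolding tree_edges_def by (subst card_image) (auto simp: card_cartesian_product)
qed

text \<open>
  The tree edges suffice for this bound; a quarter of \<open>n\<close> remains since at least half of the vertices lie in full
  blocks, and a block of \<open>4 * h\<close> numbers carries \<open>4 * h - 2 \<ge> 2 * h\<close> tree edges.
\<close>
lemma card_edges_matched_forest:
  assumes "h > 0" and "4*h \<le> n"
  shows "n \<le> 4 * card (edges (matched_forest n h f))"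
proof -
  let ?s = "n div (4*h)"
  have "n < 4*h * ?s + 4*h"
    using mult_div_mod_eq[of "4*h" n] mod_less_divisor[of "4*h" n] \<open>h > 0\<close> by linarith
  moreover have "1 \<le> ?s" using assms(1,2) by (simp add: div_greater_zero_iff Suc_le_eq)
  then have "4*h \<le> 4*h * ?s" by simp
  ultimately have "n \<le> 2 * (4*h * ?s)" by linarith
  also have "\<dots> = 4 * (?s * (2*h))" by simp
  also have "?s * (2*h) \<le> ?s * (4*h - 2)"
    using \<open>h > 0\<close> by (intro mult_le_mono2) linarith
  also have "\<dots> = card (tree_edges h ?s)"
    by (simp add: card_tree_edges)
  also have "\<dots> \<le> card (edges (matched_forest n h f))"
  proof (rule card_mono)
    show "finite (edges (matched_forest n h f))"
      by (simp add: matched_forest_def tree_edges_def matching_edges_def)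
  qed (simp add: matched_forest_def)
  finally show ?thesis by simp
qed

section \<open>Degrees, covers and copies\<close>
lemma sum_degree:
  assumes "fin_simple_graph G"
  shows "(\<Sum>v\<in>verts G. degree G v) = 2 * card (edges G)"
proof -
  have fin: "finite (verts G)" and E: "edges G \<subseteq> [verts G]\<^bsup>2\<^esup>"
    using assms by (auto simp: fin_simple_graph_def)
  then have finE: "finite (edges G)"
    by (meson finite_imp_finite_nsets finite_subset)
  have "(\<Sum>v\<in>verts G. degree G v) = (\<Sum>v\<in>verts G. \<Sum>e\<in>edges G. if v \<in> e then 1 else 0)"
    using finE by (simp add: degree_def sum.If_cases Int_def)
  also have "\<dots> = (\<Sum>e\<in>edges G. \<Sum>v\<in>verts G. if v \<in> e then 1 else 0)"
    by (rule sum.swap)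
  also have "\<dots> = (\<Sum>e\<in>edges G. 2)"
  proof (rule sum.cong[OF refl])
    fix e assume "e \<in> edges G"
    then have "e \<subseteq> verts G" "card e = 2"
      using E by (auto simp: nsets_def)
    then show "(\<Sum>v\<in>verts G. if v \<in> e then 1 else 0) = (2::nat)"
      using fin by (simp add: sum.If_cases Int_absorb1)
  qed
  finally show ?thesis by simp
qed

lemma card_high_degree_le:
  assumes "fin_simple_graph G" and "W \<subseteq> verts G" and "\<And>v. v \<in> W \<Longrightarrow> d \<le> degree G v"
  shows "card W * d \<le> 2 * card (edges G)"
proof -
  have "card W * d = (\<Sum>v\<in>W. d)" by simp
  also have "\<dots> \<le> (\<Sum>v\<in>W. degree G v)" by (intro sum_mono assms(3))
  also have "\<dots> \<le> (\<Sum>v\<in>verts G. degree G v)"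
    using assms(1,2) by (intro sum_mono2) (auto simp: fin_simple_graph_def)
  also have "\<dots> = 2 * card (edges G)" by (rule sum_degree[OF assms(1)])
  finally show ?thesis .
qed

lemma card_edges_le_vertex_cover:
  assumes "finite (edges G)" and "finite C" and "\<And>e. e \<in> edges G \<Longrightarrow> e \<inter> C \<noteq> {}"
    and "\<And>v. v \<in> C \<Longrightarrow> degree G v \<le> d"
  shows "card (edges G) \<le> card C * d"
proof -
  have "edges G \<subseteq> (\<Union>v\<in>C. {e \<in> edges G. v \<in> e})" using assms(3) by blast
  then have "card (edges G) \<le> card (\<Union>v\<in>C. {e \<in> edges G. v \<in> e})"
    using assms(1,2) by (intro card_mono) auto
  also have "\<dots> \<le> (\<Sum>v\<in>C. card {e \<in> edges G. v \<in> e})"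
    using assms(2) by (rule card_UN_le)
  also have "\<dots> \<le> (\<Sum>v\<in>C. d)"
    using assms(4) by (intro sum_mono) (simp add: degree_def)
  finally show ?thesis by simp
qed

text \<open>
  A copy seen from \<open>G'\<close>: the inverse of the isomorphism is a monochromatic embedding of \<open>G'\<close>.
\<close>
lemma mono_copy_embedding:
  assumes "mono_copy col G G'" and "fin_simple_graph G'"
  obtains g b where "inj_on g (verts G')" and "g ` verts G' \<subseteq> verts G"
    and "\<And>e. e \<in> edges G' \<Longrightarrow> g ` e \<in> edges G \<and> col (g ` e) = b"
proof -
  obtain H where H: "subgraph H G" "graph_iso H G'"
    and col: "\<And>e e'. e \<in> edges H \<Longrightarrow> e' \<in> edges H \<Longrightarrow> col e = col e'"
    using assms(1) unfolding mono_copy_def by blast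
  obtain f where f: "bij_betw f (verts H) (verts G')"
    and iso: "\<And>u v. u \<in> verts H \<Longrightarrow> v \<in> verts H \<Longrightarrow> {u, v} \<in> edges H \<longleftrightarrow> {f u, f v} \<in> edges G'"
    using H(2) unfolding graph_iso_def by blast
  define g where "g = inv_into (verts H) f"
  have g: "bij_betw g (verts G') (verts H)"
    unfolding g_def by (rule bij_betw_inv_into[OF f])
  have fg: "f (g x) = x" if "x \<in> verts G'" for x
    using bij_betw_inv_into_right[OF f that] by (simp add: g_def)
  have edge: "g ` e \<in> edges H" if "e \<in> edges G'" for e
  proof -
    have "e \<in> [verts G']\<^bsup>2\<^esup>" using assms(2) that by (auto simp: fin_simple_graph_def)
    then obtain x y where e: "e = {x, y}" "x \<in> verts G'" "y \<in> verts G'"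
      by (auto simp: nsets_def card_2_iff)
    then have "g x \<in> verts H" "g y \<in> verts H" using bij_betwE[OF g] by auto
    then show ?thesis using iso that e fg by simp
  qed
  show ?thesis
  proof
    show "inj_on g (verts G')" using g by (rule bij_betw_imp_inj_on)
    show "g ` verts G' \<subseteq> verts G"
      using bij_betw_imp_surj_on[OF g] H(1) by (simp add: subgraph_def)
    fix e assume e: "e \<in> edges G'"
    have "col (g ` e) = col (SOME e. e \<in> edges H)"
      by (rule col[OF edge[OF e] someI[of "\<lambda>e. e \<in> edges H", OF edge[OF e]]])
    then show "g ` e \<in> edges G \<and> col (g ` e) = col (SOME e. e \<in> edges H)"
      using edge[OF e] H(1) by (auto simp: subgraph_def)
  qed
qed

lemma matched_forest_component_embedding:
  assumes a: "a < n div (4*h)"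
    and inj: "inj_on g {..<n}"
    and adj: "\<And>x y. {x, y} \<in> edges (matched_forest n h f) \<Longrightarrow> adj (g x) (g y)"
  shows "rooted_embedding h (f a) adj (\<lambda>i. g (4*h*a + i))"
  unfolding rooted_embedding_def
proof (intro conjI ballI allI impI)
  have "inj_on (g \<circ> (\<lambda>i. 4*h*a + i)) {1..<4*h}"
    by (intro comp_inj_on inj_on_subset[OF inj] image_subsetI) (auto intro: block_less[OF a])
  then show "inj_on (\<lambda>i. g (4*h*a + i)) {1..<4*h}" by (simp add: comp_def)
next
  fix i assume "i \<in> {2..<4*h}"
  then show "adj (g (4*h*a + i div 2)) (g (4*h*a + i))"
    using a by (intro adj) (force simp: matched_forest_def tree_edges_def)
next
  fix i assume "i < h"
  then show "adj (g (4*h*a + (2*h + i))) (g (4*h*a + (3*h + f a i)))"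
    using a by (intro adj) (force simp: matched_forest_def matching_edges_def)
qed

lemma neighbour_enumeration:
  assumes "\<And>u. finite {v. adj u v}" and "\<And>u. card {v. adj u v} \<le> D"
  shows "\<exists>nb. \<forall>u v. adj u v \<longrightarrow> (\<exists>a<D. nb u a = v)"
proof -
  have "\<exists>enum. {v. adj u v} = enum ` {i. i < card {v. adj u v}}" for u
    using finite_imp_nat_seg_image_inj_on[OF assms(1)[of u]] by (metis card_image card_Collect_less_nat)
  then obtain nb where "\<And>u. {v. adj u v} = nb u ` {i. i < card {v. adj u v}}" by metis
  then show ?thesis using assms(2) by (smt (verit) imageE mem_Collect_eq order_less_le_trans)
qed

section \<open>The lower bound for a fixed choice of types\<close>

text \<open>
  Every vertex is the root of embeddings of at most \<open>q\<close> types, since all of these types are decoded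
  from the coincidence relation of the walks from that one vertex.  Double counting pairs of a root and
  a type then gives a type with at most the average number of roots.
\<close>
lemma few_roots:
  fixes f :: "nat \<Rightarrow> nat \<Rightarrow> nat"
  assumes "s > 0" "D > 0" and h: "h = 2^l"
    and perm: "\<And>a. a < s \<Longrightarrow> f a permutes {..<h}"
    and rare: "\<And>E. E \<subseteq> words D (l+2) \<times> words D (l+1) \<Longrightarrow>
      card {a\<in>{..<s}. f a \<in> decodable D h E} \<le> q"
    and fin: "\<And>u. finite {v. adj u v}" and deg: "\<And>u. card {v. adj u v} \<le> D"
    and W: "finite W"
  shows "\<exists>a<s. s * card {v\<in>W. \<exists>\<phi>. rooted_embedding h (f a) adj \<phi> \<and> \<phi> 1 = v} \<le> card W * q"
proof -
  let ?R = "\<lambda>a. {v\<in>W. \<exists>\<phi>. rooted_embedding h (f a) adj \<phi> \<and> \<phi> 1 = v}"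
  obtain nb where nb: "\<And>u v. adj u v \<Longrightarrow> \<exists>a<D. nb u a = v"
    using neighbour_enumeration[of adj D] fin deg by metis
  have types: "card {a\<in>{..<s}. v \<in> ?R a} \<le> q" for v
  proof -
    let ?E = "{(u, w) \<in> words D (l+2) \<times> words D (l+1). walk nb v u = walk nb v w}"
    have "{a\<in>{..<s}. v \<in> ?R a} \<subseteq> {a\<in>{..<s}. f a \<in> decodable D h ?E}"
    proof
      fix a assume a: "a \<in> {a\<in>{..<s}. v \<in> ?R a}"
      then obtain \<phi> where \<phi>: "rooted_embedding h (f a) adj \<phi>" and root: "\<phi> 1 = v"
        by blast
      have "f a \<in> decodable D h ?E"
        unfolding root[symmetric]
        by (rule embedding_imp_decodable[OF \<phi> _ h nb \<open>D > 0\<close>]) (use a perm in auto)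
      then show "a \<in> {a\<in>{..<s}. f a \<in> decodable D h ?E}"
        using a by blast
    qed
    then have "card {a\<in>{..<s}. v \<in> ?R a} \<le> card {a\<in>{..<s}. f a \<in> decodable D h ?E}"
      by (intro card_mono) auto
    also have "\<dots> \<le> q" by (rule rare) auto
    finally show ?thesis .
  qed
  have "(\<Sum>a<s. card (?R a)) = (\<Sum>a<s. \<Sum>v\<in>W. if v \<in> ?R a then 1 else 0)"
    using W by (simp add: sum.If_cases Int_def)
  also have "\<dots> = (\<Sum>v\<in>W. card {a\<in>{..<s}. v \<in> ?R a})"
    by (subst sum.swap) (simp add: sum.If_cases Int_def)
  also have "\<dots> \<le> (\<Sum>v\<in>W. q)" by (intro sum_mono types)
  finally have total: "(\<Sum>a<s. card (?R a)) \<le> card W * q" by simp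
  show ?thesis
  proof (rule ccontr)
    assume "\<not> ?thesis"
    then have "(\<Sum>a<s. card W * q) < (\<Sum>a<s. s * card (?R a))"
      using \<open>s > 0\<close> by (intro sum_strict_mono) (auto simp: not_le)
    then have "s * (card W * q) < s * (\<Sum>a<s. card (?R a))" by (simp add: sum_distrib_left)
    with total show False by simp
  qed
qed

lemma size_ramsey_host:
  assumes "fin_simple_graph G'"
  obtains G :: "nat graph" where "ramsey_host G G'" "card (edges G) = size_ramsey G'"
proof -
  have "\<exists>m. \<exists>G :: nat graph. ramsey_host G G' \<and> card (edges G) = m"
    using ramsey_host_exists[OF assms] by blast
  then have "\<exists>G :: nat graph. ramsey_host G G' \<and> card (edges G) = size_ramsey G'"
    unfolding size_ramsey_def by (rule LeastI_ex)
  then show ?thesis using that by blast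
qed

text \<open>
  With \<open>m\<close> edges in the host, handshaking gives \<open>card L \<le> 2 * m / D\<close>, and at most \<open>2 * m\<close> vertices
  can be roots, so \<open>card R \<le> 2 * m * q / s \<le> 2 * m / D\<close>.  The constant \<open>48\<close> makes each of these less than
  \<open>n / 24\<close>, and the vertex cover argument needs \<open>card (L \<union> R) < n / 12\<close>.
\<close>
lemma ramsey_host_edges_ge:
  fixes G :: "'a graph"
  assumes "h = 2^l" and "D > 0" and "4*h \<le> n" and s: "s = n div (4*h)"
    and perm: "\<And>a. a < s \<Longrightarrow> f a permutes {..<h}"
    and rare: "\<And>E. E \<subseteq> words D (l+2) \<times> words D (l+1) \<Longrightarrow>
      card {a\<in>{..<s}. f a \<in> decodable D h E} \<le> q"
    and Dq: "D * q \<le> s"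
    and host: "ramsey_host G (matched_forest n h f)"
  shows "n * D \<le> 48 * card (edges G)"
proof (rule ccontr)
  assume "\<not> ?thesis"
  then have few: "48 * card (edges G) < n * D" by simp
  have "h > 0" using \<open>h = 2^l\<close> by simp
  then have "s > 0" using \<open>4*h \<le> n\<close> by (simp add: s div_greater_zero_iff)
  let ?G' = "matched_forest n h f"
  have simple': "fin_simple_graph ?G'"
    using perm by (intro matched_forest_simple) (simp add: s)
  have simple: "fin_simple_graph G"
    using host by (simp add: ramsey_host_def)
  then have finV: "finite (verts G)" and E: "edges G \<subseteq> [verts G]\<^bsup>2\<^esup>"
    by (auto simp: fin_simple_graph_def)
  have finE: "finite (edges G)"
    using finV E by (meson finite_imp_finite_nsets finite_subset)
  define L where "L = {v \<in> verts G. D < degree G v}"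
  define adj where "adj u v \<longleftrightarrow> {u, v} \<in> edges G \<and> u \<notin> L \<and> v \<notin> L" for u v
  define W where "W = {v \<in> verts G. 1 \<le> degree G v}"
  have adj_verts: "u \<in> verts G" "v \<in> verts G" "u \<noteq> v" if "adj u v" for u v
    using that E by (auto simp: adj_def nsets_def card_2_iff doubleton_eq_iff)
  have adj_fin: "finite {v. adj u v}" for u
    by (rule finite_subset[OF _ finV]) (auto dest: adj_verts)
  have adj_deg: "card {v. adj u v} \<le> D" for u
  proof (cases "\<exists>v. adj u v")
    case True
    then obtain v where v: "adj u v" by blast
    then have u: "degree G u \<le> D" using adj_verts(1)[OF v] by (auto simp: adj_def L_def)
    have "inj_on (\<lambda>v. {u, v}) {v. adj u v}"
      by (auto simp: inj_on_def doubleton_eq_iff)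
    moreover have "(\<lambda>v. {u, v}) ` {v. adj u v} \<subseteq> {e \<in> edges G. u \<in> e}"
      by (auto simp: adj_def)
    ultimately have "card {v. adj u v} \<le> degree G u"
      unfolding degree_def using finE by (intro card_inj_on_le) auto
    with u show ?thesis by simp
  qed simp
  have adj_W: "u \<in> W" if "adj u v" for u v
  proof -
    have "{u, v} \<in> {e \<in> edges G. u \<in> e}" using that by (simp add: adj_def)
    then have "degree G u \<noteq> 0" unfolding degree_def using finE by auto
    then show ?thesis using adj_verts(1)[OF that] by (simp add: W_def)
  qed
  let ?R = "\<lambda>a. {v\<in>W. \<exists>\<phi>. rooted_embedding h (f a) adj \<phi> \<and> \<phi> 1 = v}"
  have "\<exists>a<s. s * card (?R a) \<le> card W * q"
    by (rule few_roots[OF \<open>s > 0\<close> \<open>D > 0\<close> \<open>h = 2^l\<close> perm rare adj_fin adj_deg])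
       (auto simp: W_def finV)
  then obtain a where "a < s" and Ra: "s * card (?R a) \<le> card W * q" by blast
  define R where "R = ?R a"
  define X where "X = L \<union> R"
  have finX: "finite X" using finV by (simp add: X_def L_def R_def W_def)
  have "24 * card L < n"
  proof -
    have "card L * D \<le> 2 * card (edges G)"
      by (rule card_high_degree_le[OF simple]) (auto simp: L_def)
    then have "24 * card L * D < n * D" using few by linarith
    then show ?thesis by simp
  qed
  moreover have "24 * card R < n"
  proof -
    have "card W * 1 \<le> 2 * card (edges G)"
      by (rule card_high_degree_le[OF simple]) (auto simp: W_def)
    then have "24 * card W < n * D" using few by linarith
    have "(24 * card R) * s \<le> (24 * card W) * q" using Ra by (simp add: R_def mult_ac)
    also have "\<dots> \<le> (n * D - 1) * q"
      using \<open>24 * card W < n * D\<close> by (intro mult_le_mono1) simp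
    finally have "(24 * card R) * s \<le> (n * D - 1) * q" .
    moreover have "(n * D - 1) * q < n * s"
    proof (cases "q = 0")
      case True
      then show ?thesis using \<open>s > 0\<close> \<open>4*h \<le> n\<close> \<open>h > 0\<close> by simp
    next
      case False
      then have "(n * D - 1) * q < n * D * q"
        using \<open>24 * card W < n * D\<close> by simp
      also have "\<dots> \<le> n * s" using Dq by (simp add: mult.assoc)
      finally show ?thesis .
    qed
    ultimately have "(24 * card R) * s < n * s" by linarith
    then show ?thesis by simp
  qed
  ultimately have "24 * (card L + card R) < 2 * n" by simp
  then have X_small: "12 * card X < n"
    using card_Un_le[of L R] by (simp add: X_def)
  define col where "col e \<longleftrightarrow> e \<inter> X = {}" for e
  have "mono_copy col G ?G'" using host by (simp add: ramsey_host_def)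
  then obtain g b where inj: "inj_on g (verts ?G')" and gV: "g ` verts ?G' \<subseteq> verts G"
    and g: "\<And>e. e \<in> edges ?G' \<Longrightarrow> g ` e \<in> edges G \<and> col (g ` e) = b"
    using mono_copy_embedding[OF _ simple'] by metis
  have verts': "verts ?G' = {..<n}" by (simp add: matched_forest_def)
  show False
  proof (cases b)
    case True
    \<comment> \<open>All edges of the copy avoid \<open>X\<close>, so component \<open>a\<close> is embedded away from \<open>L\<close> and its root is in \<open>R\<close>.\<close>
    have emb: "rooted_embedding h (f a) adj (\<lambda>i. g (4*h*a + i))" (is "rooted_embedding _ _ _ ?\<phi>")
    proof (rule matched_forest_component_embedding)
      show "a < n div (4*h)" using \<open>a < s\<close> by (simp add: s)
      show "inj_on g {..<n}" using inj by (simp add: verts')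
      fix x y assume "{x, y} \<in> edges ?G'"
      then show "adj (g x) (g y)"
        using g[of "{x, y}"] True by (auto simp: adj_def col_def X_def)
    qed
    have "{4*h*a + 1, 4*h*a + 2} \<in> edges ?G'"
      using \<open>a < s\<close> \<open>h > 0\<close> unfolding matched_forest_def tree_edges_def s
      by (force intro!: image_eqI[of _ _ "(a, 2)"])
    then have root: "col {?\<phi> 1, ?\<phi> 2}" "?\<phi> 1 \<notin> X"
      using g[of "{4*h*a + 1, 4*h*a + 2}"] True by (auto simp: col_def)
    have "adj (?\<phi> (2 div 2)) (?\<phi> 2)"
    proof -
      have "2 \<in> {2..<4*h}" using \<open>h > 0\<close> by simp
      then show ?thesis using emb unfolding rooted_embedding_def by blast
    qed
    then have "?\<phi> 1 \<in> W" using adj_W by simp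
    then have "?\<phi> 1 \<in> R" using emb by (auto simp: R_def)
    with root show False by (simp add: X_def)
  next
    case False
    \<comment> \<open>All edges of the copy meet \<open>X\<close>, so the preimage of \<open>X\<close> covers \<open>G'\<close>.\<close>
    define C where "C = {x \<in> {..<n}. g x \<in> X}"
    have "card (edges ?G') \<le> card C * 3"
    proof (rule card_edges_le_vertex_cover)
      show "finite (edges ?G')"
        using simple' by (meson finite_imp_finite_nsets finite_subset fin_simple_graph_def)
      show "degree ?G' v \<le> 3" for v
        using perm by (intro matched_forest_degree_le) (simp add: s)
      fix e assume e: "e \<in> edges ?G'"
      then have "e \<subseteq> {..<n}" using simple' by (auto simp: fin_simple_graph_def verts' nsets_def)
      moreover have "g ` e \<inter> X \<noteq> {}" using g[OF e] False by (simp add: col_def)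
      ultimately show "e \<inter> C \<noteq> {}" by (auto simp: C_def)
    qed (simp add: C_def)
    moreover have "card C \<le> card X"
      using inj finX by (intro card_inj_on_le[of g]) (auto simp: C_def verts' inj_on_def)
    moreover have "n \<le> 4 * card (edges ?G')"
      by (rule card_edges_matched_forest[OF \<open>h > 0\<close> \<open>4*h \<le> n\<close>])
    ultimately show False using X_small by linarith
  qed
qed

lemma exists_subcubic_graph_large_size_ramsey:
  assumes "h = 2^l" and "D > 0" and "4*h \<le> n" and s: "s = n div (4*h)"
    and many: "D ^ (6*h) * s \<le> fact h" and large: "D * (D ^ (2*l+3) + 1) \<le> s"
  shows "\<exists>G' :: nat graph. fin_simple_graph G' \<and> card (verts G') = n \<and> max_degree G' \<le> 3 \<and>
    n * D \<le> 48 * size_ramsey G'"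
proof -
  have "h > 0" using \<open>h = 2^l\<close> by simp
  then have "s > 0" using \<open>4*h \<le> n\<close> by (simp add: s div_greater_zero_iff)
  obtain f where perm: "\<And>a. a < s \<Longrightarrow> f a permutes {..<h}"
    and rare: "\<And>E. E \<subseteq> words D (l+2) \<times> words D (l+1) \<Longrightarrow>
       card {a\<in>{..<s}. f a \<in> decodable D h E} \<le> D ^ (2*l+3) + 1"
    using exists_rarely_decodable_family[OF \<open>s > 0\<close> many, of l] by blast
  let ?G' = "matched_forest n h f"
  have simple: "fin_simple_graph ?G'"
    using perm by (intro matched_forest_simple) (simp add: s)
  obtain G :: "nat graph" where G: "ramsey_host G ?G'" "card (edges G) = size_ramsey ?G'"
    using size_ramsey_host[OF simple] by blast
  have "n * D \<le> 48 * card (edges G)"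
    by (rule ramsey_host_edges_ge[OF assms(1-4) perm rare large G(1)])
  moreover have "max_degree ?G' \<le> 3"
  proof -
    have "verts ?G' \<noteq> {}" "finite (verts ?G')"
      using \<open>h > 0\<close> \<open>4*h \<le> n\<close> by (auto simp: matched_forest_def lessThan_empty_iff)
    then show ?thesis
      using matched_forest_degree_le[of n h f] perm by (simp add: max_degree_def s)
  qed
  ultimately show ?thesis
    using simple G(2) by (intro exI[of _ ?G']) (simp add: matched_forest_def)
qed

text \<open>
  This serves the bounded range of \<open>n\<close> that is too small for the matched trees.
\<close>
lemma single_edge_graph:
  assumes "n \<ge> 2"
  shows "\<exists>G' :: nat graph. fin_simple_graph G' \<and> card (verts G') = n \<and> max_degree G' \<le> 3 \<and>
    1 \<le> size_ramsey G'"
proof -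
  let ?G' = "({..<n}, {{0, 1}}) :: nat graph"
  have simple: "fin_simple_graph ?G'"
    using assms by (simp add: fin_simple_graph_def nsets_def)
  have "degree ?G' v \<le> 3" for v
  proof -
    have "card {e \<in> edges ?G'. v \<in> e} \<le> card {{0::nat, 1}}"
      by (rule card_mono) auto
    then show ?thesis by (simp add: degree_def)
  qed
  then have "max_degree ?G' \<le> 3"
    using assms by (simp add: max_degree_def lessThan_empty_iff)
  moreover obtain G :: "nat graph" where G: "ramsey_host G ?G'" "card (edges G) = size_ramsey ?G'"
    using size_ramsey_host[OF simple] by blast
  have "mono_copy (\<lambda>_. True) G ?G'" using G(1) by (simp add: ramsey_host_def)
  then obtain g :: "nat \<Rightarrow> nat" where "\<And>e. e \<in> edges ?G' \<Longrightarrow> g ` e \<in> edges G"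
    using mono_copy_embedding[OF _ simple] by metis
  then have "g ` {0, 1} \<in> edges G" by simp
  moreover have "finite (edges G)"
    using G(1) by (meson finite_imp_finite_nsets finite_subset fin_simple_graph_def ramsey_host_def)
  ultimately have "1 \<le> size_ramsey ?G'"
    unfolding G(2)[symmetric] by (metis One_nat_def Suc_leI card_gt_0_iff empty_iff)
  then show ?thesis
    using simple \<open>max_degree ?G' \<le> 3\<close> by (intro exI[of _ ?G']) simp
qed

section \<open>Choice of the parameters\<close>

text \<open>
  The term \<open>n ^ n / n!\<close> of the exponential series is at most \<open>exp n\<close>.
\<close>
lemma fact_ge_power: "real n ^ n \<le> 4 ^ n * fact n"
proof -
  have "real n ^ n / fact n \<le> (\<Sum>k. real n ^ k / fact k)"
    using sum_le_suminf[OF summable_exp_generic[of "real n"], of "{n}"]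
    by (simp add: field_simps)
  also have "\<dots> = exp (real n)"
    by (simp add: exp_def field_simps)
  also have "\<dots> = exp 1 ^ n" by (simp flip: exp_of_nat_mult)
  also have "\<dots> \<le> 4 ^ n"
    using exp_le by (intro power_mono) auto
  finally show ?thesis by (simp add: field_simps)
qed

text \<open>
  On the left stand the number of codes for \<open>D = 2 ^ j\<close> and a factor that will dominate the number \<open>s\<close> of
  components.  As \<open>h!\<close> is at least \<open>(h / 4) ^ h = 2 ^ ((10 * j - 2) * h)\<close>, the factor \<open>10\<close> in the
  exponent of \<open>h\<close> leaves room for the exponents \<open>6 * j * h\<close> of the codes and \<open>2 * h\<close>.
\<close>
lemma power_le_fact_power_of_two:
  fixes h j :: nat
  assumes h: "h = 2 ^ (10*j)" and "j \<ge> 1"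
  shows "(2^j) ^ (6 * h) * 2 ^ (2 * h) \<le> (fact h :: nat)"
proof -
  have "(4::nat) ^ h = 2 ^ (2*h)"
    using power_mult[of "2::nat" 2 h] by simp
  then have "4 ^ h * ((2^j) ^ (6 * h) * 2 ^ (2 * h)) = (2::nat) ^ (2*h + (j * (6*h) + 2*h))"
    by (simp only: power_add power_mult)
  also have "\<dots> \<le> 2 ^ (10 * j * h)"
  proof (rule power_increasing)
    have "h \<le> j * h" using \<open>j \<ge> 1\<close> by simp
    then show "2*h + (j * (6*h) + 2*h) \<le> 10 * j * h" by (simp add: mult.assoc mult.left_commute)
  qed simp
  also have "\<dots> = h ^ h"
    using power_mult[of "2::nat" "10*j" h] by (simp only: h[symmetric])
  also have "\<dots> \<le> 4 ^ h * fact h"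
  proof -
    have "real (h ^ h) \<le> real (4 ^ h * fact h)"
      using fact_ge_power[of h] by simp
    then show ?thesis by (simp only: of_nat_le_iff)
  qed
  finally show ?thesis by simp
qed

text \<open>
  The lower end \<open>2 ^ (38 * j\<^sup>2)\<close> ensures \<open>D * q \<le> s\<close>, since \<open>D * q * 4 * h\<close> is at most
  \<open>2 ^ (20 * j\<^sup>2 + 14 * j + 3)\<close> and \<open>20 + 14 + 3 \<le> 38\<close>.  The upper end, which is the lower end for \<open>j + 1\<close>,
  leaves \<open>s \<le> n\<close> below \<open>2 ^ (2 * h)\<close>, since \<open>h\<close> is exponential in \<open>j\<close>.
\<close>
lemma exists_subcubic_graph_at_scale:
  fixes n j :: nat
  assumes "j \<ge> 1" and lower: "2 ^ (38 * j^2) \<le> n" and upper: "n < 2 ^ (38 * (j+1)^2)"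
  shows "\<exists>G' :: nat graph. fin_simple_graph G' \<and> card (verts G') = n \<and> max_degree G' \<le> 3 \<and>
    n * 2^j \<le> 48 * size_ramsey G'"
proof (rule exists_subcubic_graph_large_size_ramsey)
  let ?h = "2 ^ (10*j) :: nat"
  let ?s = "n div (4 * ?h)"
  have j2: "j \<le> j^2" using \<open>j \<ge> 1\<close> by (simp add: power2_eq_square)
  show "?h = 2 ^ (10*j)" "?s = n div (4 * ?h)" by (rule refl)+
  show "(2::nat) ^ j > 0" by simp
  have four_h: "4 * ?h = 2 ^ (10*j + 2)" by (simp add: power_add)
  have "10*j + 2 \<le> 38 * j^2" using j2 \<open>j \<ge> 1\<close> by linarith
  then have "(2::nat) ^ (10*j + 2) \<le> 2 ^ (38 * j^2)" by (rule power_increasing) simp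
  with lower show "4 * ?h \<le> n" unfolding four_h by linarith
  show "2 ^ j * ((2^j) ^ (2 * (10*j) + 3) + 1) \<le> ?s"
  proof -
    have "2 ^ j * ((2^j) ^ (2 * (10*j) + 3) + 1) * (4 * ?h)
        \<le> 2 ^ j * (2 * (2^j) ^ (2 * (10*j) + 3)) * (4 * ?h)"
      by (intro mult_le_mono) auto
    also have "\<dots> = 2 ^ (j + (1 + j * (2 * (10*j) + 3)) + (10*j + 2))"
      unfolding four_h by (simp only: power_add power_mult power_one_right)
    also have "\<dots> \<le> 2 ^ (38 * j^2)"
    proof (rule power_increasing)
      have "j + (1 + j * (2 * (10*j) + 3)) + (10*j + 2) = 20 * j^2 + 14 * j + 3"
        by (simp add: power2_eq_square algebra_simps)
      then show "j + (1 + j * (2 * (10*j) + 3)) + (10*j + 2) \<le> 38 * j^2"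
        using j2 \<open>j \<ge> 1\<close> by linarith
    qed simp
    also have "\<dots> \<le> n" by (rule lower)
    finally show ?thesis by (simp add: less_eq_div_iff_mult_less_eq)
  qed
  show "(2^j) ^ (6 * ?h) * ?s \<le> fact ?h"
  proof -
    have exponent: "38 * (j+1)^2 \<le> 2 * ?h"
    proof -
      have "j + 1 \<le> 2^j" using Suc_leI[OF less_exp[of j]] by (simp only: Suc_eq_plus1)
      then have "(j+1)^2 \<le> (2^j)^2" by (rule power_mono) simp
      also have "\<dots> = (2::nat) ^ (2*j)" by (simp add: power_mult mult.commute)
      finally have "38 * (j+1)^2 \<le> 2 * 2^5 * (2::nat) ^ (2*j)" by simp
      also have "\<dots> = 2 * 2 ^ (5 + 2*j)" by (simp add: power_add)
      also have "\<dots> \<le> 2 * ?h" using \<open>j \<ge> 1\<close> by (intro mult_le_mono2 power_increasing) auto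
      finally show ?thesis .
    qed
    have "(2^j) ^ (6 * ?h) * n \<le> (2^j) ^ (6 * ?h) * 2 ^ (2 * ?h)"
    proof (rule mult_le_mono2)
      have "n \<le> 2 ^ (38 * (j+1)^2)" using upper by (rule less_imp_le)
      also have "\<dots> \<le> 2 ^ (2 * ?h)" using exponent by (rule power_increasing) simp
      finally show "n \<le> 2 ^ (2 * ?h)" .
    qed
    also have "\<dots> \<le> fact ?h"
      by (rule power_le_fact_power_of_two[OF refl \<open>j \<ge> 1\<close>])
    finally have "(2^j) ^ (6 * ?h) * n \<le> fact ?h" .
    moreover have "(2^j) ^ (6 * ?h) * ?s \<le> (2^j) ^ (6 * ?h) * n"
      by (intro mult_le_mono2) simp
    ultimately show ?thesis by (rule order_trans[rotated])
  qed
qed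

lemma exists_square_scale:
  fixes n :: nat
  assumes "n \<ge> 1"
  shows "\<exists>j. 2 ^ (38 * j^2) \<le> n \<and> n < 2 ^ (38 * (j+1)^2)"
proof -
  define P where "P j \<longleftrightarrow> n < 2 ^ (38 * (j+1)^2)" for j
  have "P n"
  proof -
    have "n \<le> 38 * (n+1)^2" by (simp add: power2_eq_square)
    also have "\<dots> < 2 ^ (38 * (n+1)^2)" by (rule less_exp)
    finally show ?thesis by (simp add: P_def)
  qed
  then obtain j where j: "P j" and least: "\<And>i. i < j \<Longrightarrow> \<not> P i"
    using exists_least_iff[of P] by blast
  have "2 ^ (38 * j^2) \<le> n"
  proof (cases j)
    case 0
    then show ?thesis using assms by simp
  next
    case (Suc i)
    then show ?thesis using least[of i] by (simp add: P_def not_less)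
  qed
  then show ?thesis using j by (auto simp: P_def)
qed

lemma sqrt_ln_le_scale:
  fixes n j :: nat
  assumes "n \<ge> 1" and "n < 2 ^ (38 * (j+1)^2)"
  shows "sqrt (ln (real n)) \<le> 7 * real (j+1)"
proof -
  have "real n \<le> 2 ^ (38 * (j+1)^2)" using assms(2) by (simp add: less_imp_le)
  then have "ln (real n) \<le> ln (2 ^ (38 * (j+1)^2))"
    using assms(1) by simp
  also have "\<dots> = real (38 * (j+1)^2) * ln 2" by (subst ln_realpow) simp_all
  also have "\<dots> \<le> real (38 * (j+1)^2) * 1"
    using ln_le_minus_one[of "2::real"] by (intro mult_left_mono) auto
  also have "\<dots> = 38 * real (j+1)^2" by simp
  also have "\<dots> \<le> 7^2 * real (j+1)^2" by (rule mult_right_mono) simp_all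
  also have "\<dots> = (7 * real (j+1))^2" by (rule power_mult_distrib[symmetric])
  finally show ?thesis by (intro real_le_lsqrt) simp_all
qed

text \<open>
  For \<open>j = 0\<close> the order \<open>n\<close> is below \<open>2 ^ 38\<close> and the right-hand side is at most one, by the choice of
  \<open>c = 2 ^ (-40)\<close>.  For \<open>j \<ge> 1\<close> the factor \<open>2 ^ (j + 1)\<close> dominates \<open>exp (c * sqrt (ln n))\<close>.
\<close>
theorem theorem1p1:
  shows "\<exists>c::real. c > 0 \<and>
    (\<forall>n::nat. n \<ge> 2 \<longrightarrow>
      (\<exists>G' :: nat graph. fin_simple_graph G' \<and> card (verts G') = n \<and> max_degree G' \<le> 3 \<and>
        real (size_ramsey G') \<ge> c * real n * exp (c * sqrt (ln (real n)))))"
proof (rule exI[of _ "1 / 2^40"], intro conjI allI impI)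
  let ?c = "1 / 2^40 :: real"
  show "?c > 0" by simp
  fix n :: nat assume "n \<ge> 2"
  then obtain j where j: "2 ^ (38 * j^2) \<le> n" "n < 2 ^ (38 * (j+1)^2)"
    using exists_square_scale[of n] by auto
  have exp_bound: "exp (?c * sqrt (ln (real n))) \<le> 2 ^ (j+1)"
  proof -
    have "?c * sqrt (ln (real n)) \<le> ?c * (7 * real (j+1))"
      using sqrt_ln_le_scale[OF _ j(2)] \<open>n \<ge> 2\<close> by (intro mult_left_mono) auto
    also have "\<dots> \<le> real (j+1) * (1/2)" by simp
    also have "\<dots> \<le> real (j+1) * ln 2"
    proof (rule mult_left_mono)
      show "1/2 \<le> ln (2::real)"
        using ln_le_minus_one[of "1/2::real"] by (simp add: ln_div)
    qed simp
    finally have "exp (?c * sqrt (ln (real n))) \<le> exp (real (j+1) * ln 2)" by simp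
    also have "\<dots> = 2 ^ (j+1)" by (simp only: exp_of_nat_mult exp_ln zero_less_numeral)
    finally show ?thesis .
  qed
  show "\<exists>G' :: nat graph. fin_simple_graph G' \<and> card (verts G') = n \<and> max_degree G' \<le> 3 \<and>
      real (size_ramsey G') \<ge> ?c * real n * exp (?c * sqrt (ln (real n)))"
  proof (cases "j = 0")
    case True
    obtain G' :: "nat graph" where G': "fin_simple_graph G'" "card (verts G') = n"
        "max_degree G' \<le> 3" "1 \<le> size_ramsey G'"
      using single_edge_graph[OF \<open>n \<ge> 2\<close>] by blast
    have "real n \<le> 2 ^ 38" using j(2) True by simp
    then have "?c * real n * exp (?c * sqrt (ln (real n))) \<le> ?c * 2^38 * 2 ^ (0+1)"
      using exp_bound True by (intro mult_mono) auto
    also have "\<dots> \<le> real (size_ramsey G')" using G'(4) by simp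
    finally show ?thesis using G' by blast
  next
    case False
    then obtain G' :: "nat graph" where G': "fin_simple_graph G'" "card (verts G') = n"
        "max_degree G' \<le> 3" "n * 2^j \<le> 48 * size_ramsey G'"
      using exists_subcubic_graph_at_scale[of j n] j by auto
    have "real (n * 2^j) \<le> real (48 * size_ramsey G')"
      using G'(4) by (simp only: of_nat_le_iff)
    then have large: "real n * 2^j \<le> 48 * real (size_ramsey G')" by simp
    have "?c * real n * exp (?c * sqrt (ln (real n))) \<le> ?c * real n * 2 ^ (j+1)"
      using exp_bound by (intro mult_left_mono) auto
    also have "\<dots> = 2 * ?c * (real n * 2 ^ j)" by simp
    also have "\<dots> \<le> 2 * ?c * (48 * real (size_ramsey G'))"
      using large by (intro mult_left_mono) auto
    also have "\<dots> \<le> real (size_ramsey G')" by simp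
    finally show ?thesis using G' by blast
  qed
qed

end
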